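(* There is an absolute constant $c>0$ such that for every positive integer $m$ and every partial Boolean function $g \subseteq \{0,1\}^m \times \{0,1\}$, \[\bar \chi(g) \ \ge\ c\sqrt{\mathrm{R}_{1/3}(g)},\] i.e. $\bar\chi(g)\in\Omega\left(\sqrt{\mathrm{R}_{1/3}(g)}\right)$.
   Context: Partial Boolean function: $g\subseteq\{0,1\}^m\times\{0,1\}$; $g^{-1}(b)$ is the set of $x$ with $(x,b)\in g$ and $(x,1-b)\notin g$; the valid inputs are $g^{-1}(0)\cup g^{-1}(1)$, and every non-valid input is related to both $0$ and $1$. For a relation $h\subseteq\{0,1\}^k\times S$ and $\epsilon\in[0,1/2)$, $\mathrm{R}_\epsilon(h)$ is the minimum, over randomized query algorithms $\mathcal A$ with $\Pr[(x,\mathcal A(x))\in h]\ge 1-\epsilon$ for all $x\in\{0,1\}^k$, of the maximum number of queries $\mathcal A$ makes over all inputs and internal randomness. Decision trees: a deterministic decision tree $T$ on $\{0,1\}^m$ queries at each internal node $v$ an index $q(v)$ and goes to child $v_0$ or $v_1$ according to the answer; leaves are labelled by bits; $T$ computes $g$ if it outputs $b$ on every $x\in g^{-1}(b)$. A node $v$ is identified with the subcube of inputs whose computation reaches it. $d_T(v)$ is the number of vertices on the root-to-$v$ path (the root has $d_T=1$), and $\pi(v)$ is the parent of $v$. Conflict quantities: let $\mu_0,\mu_1$ be probability distributions with $\mathrm{supp}(\mu_b)\subseteq g^{-1}(b)$. For an internal node $v$ let $p_b(v)=\Pr_{x\sim\mu_b}[x_{q(v)}=0\mid x\in v]$ and $\Delta(v)=|p_0(v)-p_1(v)|$.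 Let $R(\text{root})=1$ and $R(v)=R(\pi(v))\cdot\min_{b\in\{0,1\}}\Pr_{x\sim\mu_b}[x\in v\mid x\in\pi(v)]$ otherwise (terms with $R(v)=0$ contribute $0$ below). Define $\chi(T,(\mu_0,\mu_1))=\sum_{v\in T} d_T(v)\Delta(v)R(v)$. For a probability distribution $\mathcal Q$ over pairs $(\mu_0,\mu_1)$ with $\mathrm{supp}(\mu_b)\subseteq g^{-1}(b)$ for every pair in its support, set $\chi(T,\mathcal Q)=\mathbb E_{(\mu_0,\mu_1)\sim\mathcal Q}[\chi(T,(\mu_0,\mu_1))]$. The max conflict complexity is $\bar\chi(g)=\max_{\mathcal Q}\min_T \chi(T,\mathcal Q)$, the minimum over deterministic decision trees $T$ computing $g$ and the maximum over all such $\mathcal Q$. *)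

theory Defs
  imports "HOL-Probability.Probability" "HOL-Library.Sublist"
begin

text \<open>
  Bits are Booleans (\<open>0 = False\<close>, \<open>1 = True\<close>), and an element of \<open>{0,1}^m\<close> is a list of
  \<open>m\<close> bits, with coordinates indexed from \<open>0\<close>.
\<close>

definition cube :: "nat \<Rightarrow> bool list set" where
  "cube m = {x. length x = m}"

definition preimage :: "(bool list \<times> bool) set \<Rightarrow> bool \<Rightarrow> bool list set" where
  "preimage g b = {x. (x, b) \<in> g \<and> (x, \<not> b) \<notin> g}"

definition valid_inputs :: "(bool list \<times> bool) set \<Rightarrow> bool list set" where
  "valid_inputs g = preimage g False \<union> preimage g True"

definition partial_boolean_function :: "nat \<Rightarrow> (bool list \<times> bool) set \<Rightarrow> bool" where
  "partial_boolean_function m g \<longleftrightarrow>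
     g \<subseteq> cube m \<times> UNIV \<and>
     (\<forall>x \<in> cube m - valid_inputs g. (x, False) \<in> g \<and> (x, True) \<in> g)"

datatype 's dtree = Output 's | Query nat "'s dtree" "'s dtree"

fun indices :: "'s dtree \<Rightarrow> nat set" where
  "indices (Output s) = {}"
| "indices (Query i T0 T1) = insert i (indices T0 \<union> indices T1)"

definition dtrees :: "nat \<Rightarrow> 's dtree set" where
  "dtrees m = {T. indices T \<subseteq> {..<m}}"

fun run :: "'s dtree \<Rightarrow> bool list \<Rightarrow> 's" where
  "run (Output s) x = s"
| "run (Query i T0 T1) x = (if x ! i then run T1 x else run T0 x)"

text \<open>The answers to the successive queries made on \<open>x\<close>; its length is the number of queries.\<close>

fun answers :: "'s dtree \<Rightarrow> bool list \<Rightarrow> bool list" where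
  "answers (Output s) x = []"
| "answers (Query i T0 T1) x = x ! i # (if x ! i then answers T1 x else answers T0 x)"

definition computes :: "bool dtree \<Rightarrow> (bool list \<times> bool) set \<Rightarrow> bool" where
  "computes T g \<longleftrightarrow> (\<forall>b. \<forall>x \<in> preimage g b. run T x = b)"

text \<open>
  A randomized query algorithm is a probability distribution over deterministic decision trees;
  its cost is at most \<open>q\<close> if no tree in its support makes more than \<open>q\<close> queries on any input.
\<close>

definition randomized_algorithm :: "real \<Rightarrow> nat \<Rightarrow> (bool list \<times> 's) set \<Rightarrow> 's dtree pmf \<Rightarrow> bool" where
  "randomized_algorithm \<epsilon> k h A \<longleftrightarrow>
     set_pmf A \<subseteq> dtrees k \<and>
     (\<forall>x \<in> cube k. \<P>(T in measure_pmf A. (x, run T x) \<in> h) \<ge> 1 - \<epsilon>)"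

definition randomized_query_complexity :: "real \<Rightarrow> nat \<Rightarrow> (bool list \<times> 's) set \<Rightarrow> nat" where
  "randomized_query_complexity \<epsilon> k h =
     (LEAST q. \<exists>A. randomized_algorithm \<epsilon> k h A \<and>
        (\<forall>T \<in> set_pmf A. \<forall>x \<in> cube k. length (answers T x) \<le> q))"

text \<open>
  A node of a tree is represented by the list of answers leading to it from the root. Thus the root
  is \<open>[]\<close>, the parent of \<open>v \<noteq> []\<close> is \<open>butlast v\<close>, and the root-to-\<open>v\<close> path has
  \<open>length v + 1\<close> vertices.
\<close>

fun internal_nodes :: "'s dtree \<Rightarrow> bool list set" where
  "internal_nodes (Output s) = {}"
| "internal_nodes (Query i T0 T1) =
     insert [] (Cons False ` internal_nodes T0 \<union> Cons True ` internal_nodes T1)"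

fun query_at :: "'s dtree \<Rightarrow> bool list \<Rightarrow> nat" where
  "query_at (Query i T0 T1) [] = i"
| "query_at (Query i T0 T1) (b # v) = query_at (if b then T1 else T0) v"
| "query_at (Output s) v = undefined"

definition subcube :: "nat \<Rightarrow> 's dtree \<Rightarrow> bool list \<Rightarrow> bool list set" where
  "subcube m T v = {x \<in> cube m. prefix v (answers T x)}"

definition node_depth :: "bool list \<Rightarrow> nat" where
  "node_depth v = length v + 1"

text \<open>
  Conditional probabilities given a null event are \<open>0\<close> by the library convention. If both
  distributions give positive weight to every step towards \<open>v\<close>, no such event is involved at
  \<open>v\<close>; otherwise \<open>node_weight\<close> is \<open>0\<close> at \<open>v\<close>.
\<close>

definition prob_zero :: "nat \<Rightarrow> 's dtree \<Rightarrow> bool list pmf \<Rightarrow> bool list \<Rightarrow> real" where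
  "prob_zero m T \<mu> v = \<P>(x in measure_pmf \<mu>. x ! query_at T v = False \<bar> x \<in> subcube m T v)"

definition node_gap :: "nat \<Rightarrow> 's dtree \<Rightarrow> bool list pmf \<times> bool list pmf \<Rightarrow> bool list \<Rightarrow> real" where
  "node_gap m T P v = \<bar>prob_zero m T (fst P) v - prob_zero m T (snd P) v\<bar>"

definition step_prob :: "nat \<Rightarrow> 's dtree \<Rightarrow> bool list pmf \<Rightarrow> bool list \<Rightarrow> real" where
  "step_prob m T \<mu> v =
     \<P>(x in measure_pmf \<mu>. x \<in> subcube m T v \<bar> x \<in> subcube m T (butlast v))"

function node_weight :: "nat \<Rightarrow> 's dtree \<Rightarrow> bool list pmf \<times> bool list pmf \<Rightarrow> bool list \<Rightarrow> real" where
  "node_weight m T P v =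
     (if v = [] then 1
      else node_weight m T P (butlast v) * min (step_prob m T (fst P) v) (step_prob m T (snd P) v))"
  by pat_completeness auto
termination
  by (relation "Wellfounded.measure (\<lambda>(m, T, P, v). length v)") auto

declare node_weight.simps [simp del]

definition conflict_pair :: "nat \<Rightarrow> 's dtree \<Rightarrow> bool list pmf \<times> bool list pmf \<Rightarrow> real" where
  "conflict_pair m T P =
     (\<Sum>v \<in> internal_nodes T. real (node_depth v) * node_gap m T P v * node_weight m T P v)"

definition conflict :: "nat \<Rightarrow> 's dtree \<Rightarrow> (bool list pmf \<times> bool list pmf) pmf \<Rightarrow> real" where
  "conflict m T Q = measure_pmf.expectation Q (conflict_pair m T)"

text \<open>
  Restricting to discrete distributions over pairs does not change the maximum below: \<open>conflict_pair\<close>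
  is continuous on the compact space of pairs and only finitely many trees (those never repeating
  a query) matter for the minimum, so finitely supported distributions suffice by Caratheodory.
\<close>

definition pair_distributions ::
    "(bool list \<times> bool) set \<Rightarrow> (bool list pmf \<times> bool list pmf) pmf set" where
  "pair_distributions g =
     {Q. \<forall>(\<mu>0, \<mu>1) \<in> set_pmf Q. set_pmf \<mu>0 \<subseteq> preimage g False \<and> set_pmf \<mu>1 \<subseteq> preimage g True}"

text \<open>
  If \<open>g\<close> takes only one of the values \<open>0, 1\<close> on its valid inputs, there is no pair of
  distributions to choose from; the maximum over the empty set of nonnegative numbers is \<open>0\<close>.
  Otherwise the supremum is over a nonempty set of reals bounded above.
\<close>

definition max_conflict_complexity :: "nat \<Rightarrow> (bool list \<times> bool) set \<Rightarrow> real" where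
  "max_conflict_complexity m g =
     (if pair_distributions g = {} then 0
      else SUP Q \<in> pair_distributions g. INF T \<in> {T \<in> dtrees m. computes T g}. conflict m T Q)"

end

theory Submission
  imports Defs
begin

text \<open>
  A point mass \<open>\<Q>\<close> on a single pair \<open>(\<mu>\<^sub>0, \<mu>\<^sub>1)\<close> suffices. Let \<open>T\<close> be a tree with
  \<open>\<chi>(T, (\<mu>\<^sub>0, \<mu>\<^sub>1)) \<le> k/2\<close>, truncated at depth \<open>k\<close>. Since \<open>\<Sum>\<^sub>v \<Delta>(v) R(v) = 1\<close> for a tree computing
  \<open>g\<close>, the truncation retains conflict probability at least \<open>1/2\<close>, and by Cauchy-Schwarz
  \<open>\<Sum>\<^sub>v \<Delta>(v)\<^sup>2 R(v) \<ge> 1/(4k)\<close>. This sum controls the Bhattacharyya affinity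
  \<open>\<Sum>\<^sub>l \<surd>(\<mu>\<^sub>0(l) \<mu>\<^sub>1(l))\<close> over the leaves of the truncation, which is therefore at most \<open>1 - 1/(8k)\<close>.
  Affinity is multiplicative under conditioning, so attaching such a tree, chosen for the conditioned
  pair, at each leaf and repeating \<open>8k\<close> times gives a tree of depth \<open>8k\<^sup>2\<close> with affinity at most
  \<open>1/2\<close>, hence with distributional error at most \<open>1/4\<close> for any prior. The minimax argument
  (by multiplicative weights) turns this into a randomized algorithm with error \<open>1/3\<close>.
\<close>

section \<open>Truncation, affinity and the conflict of a subtree\<close>

fun tree_height :: "'s dtree \<Rightarrow> nat" where
  "tree_height (Output s) = 0"
| "tree_height (Query i T0 T1) = Suc (max (tree_height T0) (tree_height T1))"

text \<open>The label at a cut is arbitrary: \<open>affinity\<close> ignores labels, and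
  \<open>ex_labelling\<close> chooses them at the end.\<close>

fun truncate :: "nat \<Rightarrow> 's dtree \<Rightarrow> 's dtree" where
  "truncate j (Output s) = Output s"
| "truncate 0 (Query i T0 T1) = Output undefined"
| "truncate (Suc j) (Query i T0 T1) = Query i (truncate j T0) (truncate j T1)"

text \<open>The unnormalised Bhattacharyya coefficient of the leaves reached from \<open>A\<close>
  and from \<open>B\<close>. Without normalisation it is additive over subtrees, with no
  conditioning on null sets. In use \<open>A\<close> and \<open>B\<close> are disjoint, so a single
  \<open>w\<close> carries both distributions.\<close>

fun affinity :: "(bool list \<Rightarrow> real) \<Rightarrow> 's dtree \<Rightarrow> bool list set \<Rightarrow> bool list set \<Rightarrow> real" where
  "affinity w (Output s) A B = sqrt (sum w A * sum w B)"
| "affinity w (Query i T0 T1) A B =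
     affinity w T0 {x \<in> A. x ! i = False} {x \<in> B. x ! i = False} +
     affinity w T1 {x \<in> A. x ! i = True} {x \<in> B. x ! i = True}"

text \<open>Like \<open>prob_zero\<close> and \<open>step_prob\<close>, \<open>branch\<close> is \<open>0\<close> when conditioning on a null set.\<close>

definition branch :: "(bool list \<Rightarrow> real) \<Rightarrow> bool list set \<Rightarrow> nat \<Rightarrow> bool \<Rightarrow> real" where
  "branch w A i b = sum w {x \<in> A. x ! i = b} / sum w A"

text \<open>
  The conflict quantity of a subtree whose root has \<open>e\<close> proper ancestors, for the restrictions of
  the weight \<open>w\<close> to \<open>A\<close> and \<open>B\<close> and with \<open>R = 1\<close> at the root of the subtree.
\<close>

fun weighted_conflict ::
    "(bool list \<Rightarrow> real) \<Rightarrow> nat \<Rightarrow> 's dtree \<Rightarrow> bool list set \<Rightarrow> bool list set \<Rightarrow> real" where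
  "weighted_conflict w e (Output s) A B = 0"
| "weighted_conflict w e (Query i T0 T1) A B =
     real (e + 1) * \<bar>branch w A i False - branch w B i False\<bar> +
     min (branch w A i False) (branch w B i False) *
       weighted_conflict w (e + 1) T0 {x \<in> A. x ! i = False} {x \<in> B. x ! i = False} +
     min (branch w A i True) (branch w B i True) *
       weighted_conflict w (e + 1) T1 {x \<in> A. x ! i = True} {x \<in> B. x ! i = True}"

definition normalized :: "(bool list \<Rightarrow> real) \<Rightarrow> bool list set \<Rightarrow> bool list pmf" where
  "normalized w A = embed_pmf (\<lambda>x. if x \<in> A then w x / sum w A else 0)"

section \<open>Full query trees and valid inputs\<close>

lemma length_answers_le_height: "length (answers T x) \<le> tree_height T"
  by (induction T) auto

lemma height_truncate: "tree_height (truncate j T) \<le> j"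
  by (induction j T rule: truncate.induct) auto

lemma indices_truncate: "indices (truncate j T) \<subseteq> indices T"
  by (induction j T rule: truncate.induct) auto

lemma finite_cube: "finite (cube m)"
  using finite_lists_length_eq[of "UNIV :: bool set" m] by (simp add: cube_def)

lemma finite_internal_nodes: "finite (internal_nodes T)"
  by (induction T) auto

text \<open>The root queries the last of the coordinates read, so the subtrees need only the first
  \<open>j\<close> bits.\<close>

lemma ex_dtree_run:
  "\<exists>T \<in> dtrees j. \<forall>x. j \<le> length x \<longrightarrow> run T x = f (take j x)"
proof (induction j arbitrary: f)
  case 0
  show ?case by (intro bexI[of _ "Output (f [])"]) (auto simp: dtrees_def)
next
  case (Suc j)
  obtain T where T: "\<And>b. T b \<in> dtrees j"
    "\<And>b x. j \<le> length x \<Longrightarrow> run (T b) x = f (take j x @ [b])"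
    using Suc[of "\<lambda>y. f (y @ [b])" for b] by metis
  have "Query j (T False) (T True) \<in> dtrees (Suc j)"
    using T(1) by (force simp: dtrees_def)
  moreover have "run (Query j (T False) (T True)) x = f (take (Suc j) x)" if "Suc j \<le> length x" for x
    using that T(2)[of x True] T(2)[of x False] by (cases "x ! j") (auto simp: take_Suc_conv_app_nth)
  ultimately show ?case by blast
qed

lemma preimage_subset_cube:
  assumes "partial_boolean_function m g"
  shows "preimage g b \<subseteq> cube m"
  using assms by (auto simp: partial_boolean_function_def preimage_def)

text \<open>A non-valid input is related to both bits, so an answer can be wrong only on a valid
  input of the other value.\<close>

lemma notin_iff_preimage:
  assumes "partial_boolean_function m g" "x \<in> cube m"
  shows "(x, b) \<notin> g \<longleftrightarrow> x \<in> preimage g (\<not> b)"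
proof (cases "x \<in> valid_inputs g")
  case True
  thus ?thesis by (cases b) (auto simp: valid_inputs_def preimage_def)
next
  case False
  hence "(x, False) \<in> g" "(x, True) \<in> g" "x \<notin> preimage g (\<not> b)"
    using assms by (simp_all add: partial_boolean_function_def valid_inputs_def) (cases b; simp)
  thus ?thesis by (cases b) auto
qed

text \<open>Makes the infimum in \<open>max_conflict_complexity\<close> one over a nonempty
  set.\<close>

lemma ex_dtree_computes:
  assumes "partial_boolean_function m g"
  shows "\<exists>T \<in> dtrees m. computes T g"
proof -
  obtain T where T: "T \<in> dtrees m" "\<And>x. m \<le> length x \<Longrightarrow> run T x = ((take m x, False) \<notin> g)"
    using ex_dtree_run[of m "\<lambda>x. (x, False) \<notin> g"] by blast
  have "run T x = b" if "x \<in> preimage g b" for x b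
  proof -
    have "length x = m" using that preimage_subset_cube[OF assms] by (auto simp: cube_def)
    thus ?thesis using T(2)[of x] that by (cases b) (auto simp: preimage_def)
  qed
  thus ?thesis using T(1) by (auto simp: computes_def)
qed

section \<open>From a sum over nodes to a recursion over subtrees\<close>

lemma measure_normalized:
  assumes "finite A" "\<And>x. 0 \<le> w x" "0 < sum w A"
  shows "measure (measure_pmf (normalized w A)) S = sum w (A \<inter> S) / sum w A"
proof -
  let ?f = "\<lambda>x. if x \<in> A then w x / sum w A else 0"
  have nn: "0 \<le> ?f x" for x using assms by (simp add: sum_nonneg)
  have "(\<integral>\<^sup>+x. ennreal (?f x) \<partial>count_space UNIV) = (\<Sum>x\<in>A. ennreal (?f x))"
    using assms(1) by (intro nn_integral_count_space') auto
  also have "\<dots> = ennreal (\<Sum>x\<in>A. ?f x)"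
    by (rule sum_ennreal) (rule nn)
  also have "(\<Sum>x\<in>A. ?f x) = 1"
    using assms by (simp flip: sum_divide_distrib)
  finally have pmf: "pmf (normalized w A) x = ?f x" for x
    unfolding normalized_def using nn by (intro pmf_embed_pmf) auto
  have "set_pmf (normalized w A) \<subseteq> A"
    by (auto simp: set_pmf_eq pmf split: if_splits)
  hence "measure (measure_pmf (normalized w A)) S = measure (measure_pmf (normalized w A)) (A \<inter> S)"
    by (intro measure_eq_AE) (auto simp: AE_measure_pmf_iff)
  also have "\<dots> = (\<Sum>x\<in>A \<inter> S. ?f x)"
    using assms(1) by (simp add: measure_measure_pmf_finite pmf)
  also have "\<dots> = sum w (A \<inter> S) / sum w A"
    by (simp add: sum_divide_distrib)
  finally show ?thesis .
qed

lemma set_pmf_normalized: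
  assumes "finite A" "\<And>x. 0 \<le> w x" "0 < sum w A"
  shows "set_pmf (normalized w A) \<subseteq> A"
proof
  fix x assume "x \<in> set_pmf (normalized w A)"
  hence "measure (measure_pmf (normalized w A)) {x} \<noteq> 0"
    by (simp add: measure_pmf_single set_pmf_iff)
  thus "x \<in> A" using measure_normalized[of A w "{x}", OF assms] by (cases "x \<in> A") auto
qed

text \<open>\<open>conflict_pair\<close> refers to paths from the root of \<open>T\<close>, which
  blocks structural induction. The last two assumptions express that \<open>S\<close> hangs at
  \<open>u\<close> in \<open>T\<close>; \<open>node_weight\<close> at \<open>u\<close> factors out
  because it is a product along the path.\<close>

lemma conflict_subtree:
  fixes w :: "bool list \<Rightarrow> real"
  assumes w: "\<And>x. 0 \<le> w x"
    and A: "finite A" "0 < sum w A" and B: "finite B" "0 < sum w B"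
    and P: "P = (normalized w A, normalized w B)"
    and "\<And>x. x \<in> cube m \<Longrightarrow> prefix u (answers T x) \<Longrightarrow> answers T x = u @ answers S x"
    and "\<And>v. query_at T (u @ v) = query_at S v"
  shows "(\<Sum>v \<in> internal_nodes S.
            real (node_depth (u @ v)) * node_gap m T P (u @ v) * node_weight m T P (u @ v)) =
         node_weight m T P u *
            weighted_conflict w (length u) S (A \<inter> subcube m T u) (B \<inter> subcube m T u)"
  using assms(7-8)
proof (induction S arbitrary: u)
  case (Output s)
  show ?case by simp
next
  case (Query i S0 S1)
  let ?S = "\<lambda>b. if b then S1 else S0"
  let ?t = "\<lambda>v. real (node_depth v) * node_gap m T P v * node_weight m T P v"
  note meas = measure_normalized[OF _ w]
  have ans: "answers T x = u @ x ! i # answers (?S (x ! i)) x"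
    if "x \<in> cube m" "prefix u (answers T x)" for x
    using Query.prems(1)[OF that] by simp
  have ans_child: "answers T x = (u @ [b]) @ answers (?S b) x"
    if "x \<in> cube m" "prefix (u @ [b]) (answers T x)" for x b
  proof -
    have "answers T x = u @ x ! i # answers (?S (x ! i)) x"
      using ans[OF that(1) append_prefixD[OF that(2)]] .
    moreover from this that(2) have "b = x ! i" by simp
    ultimately show ?thesis by simp
  qed
  have query_child: "query_at T ((u @ [b]) @ v) = query_at (?S b) v" for b v
    using Query.prems(2)[of "b # v"] by simp
  have sub: "subcube m T (u @ [b]) = {x \<in> subcube m T u. x ! i = b}" for b
  proof -
    have "x \<in> subcube m T (u @ [b]) \<longleftrightarrow> x \<in> subcube m T u \<and> x ! i = b" for x
    proof (cases "x \<in> subcube m T u")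
      case True
      hence x: "x \<in> cube m" "prefix u (answers T x)" by (auto simp: subcube_def)
      hence "prefix (u @ [b]) (answers T x) \<longleftrightarrow> x ! i = b" by (subst ans) auto
      thus ?thesis using x by (simp add: subcube_def)
    next
      case False
      thus ?thesis using append_prefixD[of u "[b]" "answers T x"] by (auto simp: subcube_def)
    qed
    thus ?thesis by blast
  qed
  have query: "query_at T u = i"
    using Query.prems(2)[of "[]"] by simp
  have step: "step_prob m T (normalized w C) (u @ [b]) = branch w (C \<inter> subcube m T u) i b"
    if "finite C" "0 < sum w C" for C b
  proof -
    have "{x. x \<in> subcube m T (u @ [b]) \<and> x \<in> subcube m T u} = subcube m T (u @ [b])"
      by (auto simp: sub)
    moreover have "C \<inter> subcube m T (u @ [b]) = {x \<in> C \<inter> subcube m T u. x ! i = b}"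
      by (auto simp: sub)
    ultimately show ?thesis using that
      by (simp add: step_prob_def cond_prob_def meas branch_def)
  qed
  have zero: "prob_zero m T (normalized w C) u = branch w (C \<inter> subcube m T u) i False"
    if "finite C" "0 < sum w C" for C
  proof -
    have "C \<inter> {x. \<not> x ! i \<and> x \<in> subcube m T u} = {x \<in> C \<inter> subcube m T u. x ! i = False}"
      by auto
    thus ?thesis using that
      by (simp add: prob_zero_def cond_prob_def meas branch_def query)
  qed
  have gap: "node_gap m T P u =
      \<bar>branch w (A \<inter> subcube m T u) i False - branch w (B \<inter> subcube m T u) i False\<bar>"
    using A B by (simp add: node_gap_def P zero)
  have weight: "node_weight m T P (u @ [b]) = node_weight m T P u *
      min (branch w (A \<inter> subcube m T u) i b) (branch w (B \<inter> subcube m T u) i b)" for b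
    using A B by (subst node_weight.simps) (simp add: P step)
  have child: "(\<Sum>v \<in> internal_nodes (?S b). ?t (u @ b # v)) =
      node_weight m T P (u @ [b]) * weighted_conflict w (length u + 1) (?S b)
        {x \<in> A \<inter> subcube m T u. x ! i = b} {x \<in> B \<inter> subcube m T u. x ! i = b}" for b
  proof -
    have "(\<Sum>v \<in> internal_nodes (?S b). ?t ((u @ [b]) @ v)) =
      node_weight m T P (u @ [b]) * weighted_conflict w (length (u @ [b])) (?S b)
        (A \<inter> subcube m T (u @ [b])) (B \<inter> subcube m T (u @ [b]))"
      using Query.IH(1)[of "u @ [False]"] Query.IH(2)[of "u @ [True]"] ans_child query_child
      by (cases b) force+
    moreover have "C \<inter> subcube m T (u @ [b]) = {x \<in> C \<inter> subcube m T u. x ! i = b}" for C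
      by (auto simp: sub)
    ultimately show ?thesis by simp
  qed
  have "(\<Sum>v \<in> internal_nodes (Query i S0 S1). ?t (u @ v)) =
      ?t u + ((\<Sum>v \<in> Cons False ` internal_nodes S0. ?t (u @ v)) +
              (\<Sum>v \<in> Cons True ` internal_nodes S1. ?t (u @ v)))"
    by (simp add: finite_internal_nodes, subst sum.insert, auto simp: finite_internal_nodes,
        subst sum.union_disjoint, auto simp: finite_internal_nodes)
  also have "\<dots> = ?t u + ((\<Sum>v \<in> internal_nodes S0. ?t (u @ False # v)) +
                         (\<Sum>v \<in> internal_nodes S1. ?t (u @ True # v)))"
    by (simp add: sum.reindex)
  finally show ?case
    using child[of False] child[of True]
    by (simp add: gap weight node_depth_def algebra_simps)
qed

lemma conflict_pair_normalized:
  fixes w :: "bool list \<Rightarrow> real"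
  assumes "\<And>x. 0 \<le> w x"
    and "A \<subseteq> cube m" "0 < sum w A" and "B \<subseteq> cube m" "0 < sum w B"
  shows "conflict_pair m T (normalized w A, normalized w B) = weighted_conflict w 0 T A B"
proof -
  have "finite A" "finite B" using assms finite_cube finite_subset by blast+
  hence "(\<Sum>v \<in> internal_nodes T. real (node_depth ([] @ v)) *
            node_gap m T (normalized w A, normalized w B) ([] @ v) *
            node_weight m T (normalized w A, normalized w B) ([] @ v)) =
         node_weight m T (normalized w A, normalized w B) [] *
            weighted_conflict w (length ([] :: bool list)) T (A \<inter> subcube m T []) (B \<inter> subcube m T [])"
    using assms by (intro conflict_subtree) auto
  moreover have "A \<inter> subcube m T [] = A" "B \<inter> subcube m T [] = B"
    using assms by (auto simp: subcube_def)
  ultimately show ?thesis by (simp add: conflict_pair_def node_weight.simps)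
qed

section \<open>Affinity under queries\<close>

text \<open>Squaring the sum of the two roots gives a cross term that regroups as twice the product
  of the two standard deviations, at most the sum of the variances; this leaves
  \<open>1 - (p - q)^2\<close>, and \<open>1 - x\<close> is at most
  \<open>(1 - x / 2)^2\<close>.\<close>

lemma affinity_coins_le:
  fixes p q :: real
  assumes "0 \<le> p" "p \<le> 1" "0 \<le> q" "q \<le> 1"
  shows "sqrt (p * q) + sqrt ((1 - p) * (1 - q)) \<le> 1 - (p - q)\<^sup>2 / 2"
proof -
  let ?s = "sqrt (p * q)" and ?t = "sqrt ((1 - p) * (1 - q))"
  let ?a = "sqrt (p * (1 - p))" and ?b = "sqrt (q * (1 - q))"
  have "?s * ?t = ?a * ?b" by (simp add: real_sqrt_mult)
  moreover have "2 * (?a * ?b) \<le> ?a\<^sup>2 + ?b\<^sup>2"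
    using sum_squares_bound[of ?a ?b] by (simp add: mult.assoc)
  moreover have "?a\<^sup>2 = p * (1 - p)" "?b\<^sup>2 = q * (1 - q)" "?s\<^sup>2 = p * q" "?t\<^sup>2 = (1 - p) * (1 - q)"
    using assms by (auto intro!: real_sqrt_pow2 mult_nonneg_nonneg)
  ultimately have "(?s + ?t)\<^sup>2 \<le> 1 - (p - q)\<^sup>2"
    by (simp add: power2_sum power2_diff algebra_simps) (simp add: power2_eq_square)
  also have "\<dots> \<le> (1 - (p - q)\<^sup>2 / 2)\<^sup>2"
    by (simp add: power2_diff[of 1])
  finally have square: "(?s + ?t)\<^sup>2 \<le> (1 - (p - q)\<^sup>2 / 2)\<^sup>2" .
  have "(p - q)\<^sup>2 \<le> 1" using assms by (simp add: abs_square_le_1 abs_le_iff)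
  hence "0 \<le> 1 - (p - q)\<^sup>2 / 2" by linarith
  with square show ?thesis by (rule power2_le_imp_le)
qed

lemma branch_nonneg: "(\<And>x. 0 \<le> w x) \<Longrightarrow> 0 \<le> branch w A i b"
  by (simp add: branch_def sum_nonneg)

lemma sum_branch:
  assumes "finite A"
  shows "sum w A = sum w {x \<in> A. x ! i = False} + sum w {x \<in> A. x ! i = True}"
proof -
  have "A = {x \<in> A. x ! i = False} \<union> {x \<in> A. x ! i = True}" by auto
  thus ?thesis using assms by (subst sum.union_disjoint[symmetric]) auto
qed

lemma branch_True:
  assumes "finite A" "0 < sum w A"
  shows "branch w A i True = 1 - branch w A i False"
  using sum_branch[OF assms(1), of w i] assms(2) by (simp add: branch_def field_simps)

lemma branch_pos_imp_sum_pos: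
  assumes "\<And>x. 0 \<le> w x" "0 < branch w A i b"
  shows "0 < sum w {x \<in> A. x ! i = b}"
  using assms sum_nonneg[of "{x \<in> A. x ! i = b}" w] by (auto simp: branch_def less_le)

lemma sqrt_branch:
  assumes "0 < sum w A" "0 < sum w B"
  shows "sqrt (sum w {x \<in> A. x ! i = b} * sum w {x \<in> B. x ! i = b}) =
         sqrt (sum w A * sum w B) * sqrt (branch w A i b * branch w B i b)"
  using assms by (simp add: branch_def flip: real_sqrt_mult)

text \<open>Cauchy-Schwarz at each query: refining by an answer never raises the affinity.\<close>

lemma affinity_le:
  assumes "\<And>x. 0 \<le> w x" "finite A" "finite B"
  shows "affinity w T A B \<le> sqrt (sum w A * sum w B)"
  using assms(2-3)
proof (induction T arbitrary: A B)
  case (Output s)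
  show ?case by simp
next
  case (Query i T0 T1)
  have "affinity w (Query i T0 T1) A B \<le>
      sqrt (sum w {x \<in> A. x ! i = False} * sum w {x \<in> B. x ! i = False}) +
      sqrt (sum w {x \<in> A. x ! i = True} * sum w {x \<in> B. x ! i = True})"
    using Query by (auto intro!: add_mono)
  also have "\<dots> \<le> sqrt (sum w A * sum w B)"
  proof -
    have "sqrt (a * c) + sqrt (b * d) \<le> sqrt ((a + b) * (c + d))"
      if "0 \<le> a" "0 \<le> b" "0 \<le> c" "0 \<le> d" for a b c d :: real
    proof (rule real_le_rsqrt)
      have "sqrt (a * c) * sqrt (b * d) = sqrt (a * d) * sqrt (b * c)"
        by (simp add: real_sqrt_mult)
      moreover have "2 * sqrt (a * d) * sqrt (b * c) \<le> (sqrt (a * d))\<^sup>2 + (sqrt (b * c))\<^sup>2"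
        by (rule sum_squares_bound)
      ultimately show "(sqrt (a * c) + sqrt (b * d))\<^sup>2 \<le> (a + b) * (c + d)"
        using that by (simp add: power2_sum algebra_simps)
    qed
    thus ?thesis
      using sum_branch[OF Query.prems(1), of w i] sum_branch[OF Query.prems(2), of w i] assms(1)
      by (simp add: sum_nonneg)
  qed
  finally show ?case .
qed

section \<open>Conflict forces a loss of affinity\<close>

text \<open>What is kept of computing \<open>g\<close>: unlike \<open>computes\<close>, it passes to
  a subtree once \<open>A\<close> and \<open>B\<close> are cut down to the inputs that reach
  it.\<close>

definition separates :: "'s dtree \<Rightarrow> bool list set \<Rightarrow> bool list set \<Rightarrow> bool" where
  "separates T A B \<longleftrightarrow> (\<forall>x \<in> A. \<forall>y \<in> B. run T x \<noteq> run T y)"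

lemma separates_Query:
  assumes "separates (Query i T0 T1) A B"
  shows "separates T0 {x \<in> A. x ! i = False} {x \<in> B. x ! i = False}"
    and "separates T1 {x \<in> A. x ! i = True} {x \<in> B. x ! i = True}"
proof -
  have "run (Query i T0 T1) x \<noteq> run (Query i T0 T1) y" if "x \<in> A" "y \<in> B" for x y
    using assms that by (simp only: separates_def) blast
  thus "separates T0 {x \<in> A. x ! i = False} {x \<in> B. x ! i = False}"
    "separates T1 {x \<in> A. x ! i = True} {x \<in> B. x ! i = True}"
    unfolding separates_def by force+
qed

lemma not_separates_Output:
  fixes w :: "bool list \<Rightarrow> real"
  assumes "0 < sum w A" "0 < sum w B"
  shows "\<not> separates (Output s) A B"
proof -
  have "A \<noteq> {}" "B \<noteq> {}" using assms by auto
  thus ?thesis by (auto simp: separates_def)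
qed

text \<open>Allows an induction hypothesis to be used only on a child that both sides reach with
  positive weight; otherwise the factor \<open>min p q\<close> vanishes.\<close>

lemma min_mult_mono:
  fixes p q :: real
  assumes "0 \<le> p" "0 \<le> q" "0 < p \<Longrightarrow> 0 < q \<Longrightarrow> c \<le> d"
  shows "min p q * c \<le> min p q * d"
  using assms by (cases "0 < p \<and> 0 < q") (auto simp: min_def intro: mult_left_mono)

text \<open>Couple the two answers optimally: at each query they differ with probability \<Delta>,
  and otherwise both sides move on together. No leaf of a separating tree can receive both sides, so
  a conflict surely occurs, at cost at least \<open>e + 1\<close>.\<close>

lemma weighted_conflict_ge:
  assumes w: "\<And>x. 0 \<le> w x"
    and "finite A" "0 < sum w A" "finite B" "0 < sum w B" "separates T A B"
  shows "real (e + 1) \<le> weighted_conflict w e T A B"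
  using assms(2-6)
proof (induction T arbitrary: e A B)
  case (Output s)
  thus ?case using not_separates_Output[OF Output.prems(2,4), of s] by simp
next
  case (Query i T0 T1)
  define p q where "p = branch w A i False" "q = branch w B i False"
  note pos = branch_pos_imp_sum_pos[of w, OF w]
  have "min p q * real (e + 1) \<le> min p q *
      weighted_conflict w (e + 1) T0 {x \<in> A. x ! i = False} {x \<in> B. x ! i = False}"
    unfolding p_q_def
    by (intro min_mult_mono branch_nonneg w order_trans[OF _ Query.IH(1)] pos)
       (use Query.prems separates_Query in auto)
  moreover have "min (1 - p) (1 - q) * real (e + 1) \<le> min (1 - p) (1 - q) *
      weighted_conflict w (e + 1) T1 {x \<in> A. x ! i = True} {x \<in> B. x ! i = True}"
    unfolding p_q_def branch_True[OF Query.prems(1,2), symmetric] branch_True[OF Query.prems(3,4), symmetric]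
    by (intro min_mult_mono branch_nonneg w order_trans[OF _ Query.IH(2)] pos)
       (use Query.prems separates_Query in auto)
  \<comment> \<open>Under the coupling, the probabilities of differing, of both answering 0 and of
    both answering 1 add up to 1.\<close>
  moreover have "real (e + 1) = real (e + 1) * \<bar>p - q\<bar> + min p q * real (e + 1) + min (1 - p) (1 - q) * real (e + 1)"
    by (auto simp: min_def abs_if algebra_simps)
  ultimately show ?case
    using Query.prems by (simp add: branch_True p_q_def)
qed

text \<open>
  The deficit of the normalised affinity is at least \<open>\<Sum>\<^sub>v R(v) \<Delta>(v)\<^sup>2 / 2\<close> over the nodes kept by the
  truncation. The statement carries the consequence of \<open>k \<Delta>\<^sup>2 \<ge> \<Delta> - 1/(4k)\<close> and of the fact that
  the conflict probabilities \<open>R(v) \<Delta>(v)\<close> add up to \<open>1\<close> over the whole tree.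
\<close>

lemma affinity_truncate_le:
  fixes k :: nat
  assumes w: "\<And>x. 0 \<le> w x" and k: "0 < k" "e + j = k"
    and "finite A" "0 < sum w A" "finite B" "0 < sum w B" "separates T A B"
  shows "affinity w (truncate j T) A B \<le> sqrt (sum w A * sum w B) *
           (1 - (1 - weighted_conflict w e T A B / k - j / (4 * k)) / (2 * k))"
  using assms(3-)
proof (induction j T arbitrary: e A B rule: truncate.induct)
  case (1 j s)
  thus ?case using not_separates_Output[OF "1.prems"(3,5), of s] by simp
next
  \<comment> \<open>At the cut \<open>e = k\<close>, so the conflict still to come costs at least
    \<open>k\<close> and the claimed bound is no stronger than the affinity of a single
    leaf.\<close>
  case (2 i T0 T1)
  have "real k \<le> weighted_conflict w e (Query i T0 T1) A B"
    using weighted_conflict_ge[OF w "2.prems"(2-6), of e] "2.prems"(1) by linarith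
  hence "(1 - weighted_conflict w e (Query i T0 T1) A B / k) / (2 * k) \<le> 0"
    using k(1) by (simp add: divide_nonpos_pos)
  hence "sqrt (sum w A * sum w B) * 1 \<le> sqrt (sum w A * sum w B) *
      (1 - (1 - weighted_conflict w e (Query i T0 T1) A B / k) / (2 * k))"
    using w by (intro mult_left_mono) (auto simp: sum_nonneg simp del: weighted_conflict.simps)
  thus ?case by (simp del: weighted_conflict.simps)
next
  case (3 j i T0 T1)
  note prems = "3.prems"
  define p q where "p = branch w A i False" "q = branch w B i False"
  define N where "N = sqrt (sum w A * sum w B)"
  define X where "X b = weighted_conflict w (e + 1) (if b then T1 else T0) {x \<in> A. x ! i = b} {x \<in> B. x ! i = b}" for b
  define a where "a b = affinity w (truncate j (if b then T1 else T0)) {x \<in> A. x ! i = b} {x \<in> B. x ! i = b} / N" for b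
  define Y where "Y b = (1 - X b / k - j / (4 * k)) / (2 * k)" for b
  define s where "s b = sqrt (branch w A i b * branch w B i b)" for b
  have N: "0 < N" using prems by (simp add: N_def)
  have pq: "branch w A i True = 1 - p" "branch w B i True = 1 - q"
    using prems by (simp_all add: p_q_def branch_True)
  have pq01: "0 \<le> p" "p \<le> 1" "0 \<le> q" "q \<le> 1"
    using branch_nonneg[of w A i, OF w] branch_nonneg[of w B i, OF w] pq
    by (simp_all add: p_q_def) (metis diff_ge_0_iff_ge)+
  have child: "a b \<le> s b - min (branch w A i b) (branch w B i b) * Y b" for b
  proof -
    let ?A = "{x \<in> A. x ! i = b}" and ?B = "{x \<in> B. x ! i = b}"
    let ?m = "min (branch w A i b) (branch w B i b)"
    have Ns: "sqrt (sum w ?A * sum w ?B) = N * s b"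
      unfolding N_def s_def using prems by (intro sqrt_branch) auto
    have "affinity w (truncate j (if b then T1 else T0)) ?A ?B \<le> N * s b"
      unfolding Ns[symmetric] using prems by (intro affinity_le w) auto
    hence le: "a b \<le> s b" using N by (simp add: a_def field_simps)
    show ?thesis
    \<comment> \<open>If a side misses the child or the claimed gain \<open>Y b\<close> is not
      positive, \<open>affinity_le\<close> is enough. Otherwise the induction hypothesis gains
      \<open>s b * Y b\<close>, and the geometric mean \<open>s b\<close> is at least the
      minimum.\<close>
    proof (cases "0 < branch w A i b \<and> 0 < branch w B i b \<and> 0 < Y b")
      case False
      moreover have "0 \<le> branch w A i b" "0 \<le> branch w B i b" using branch_nonneg[of w, OF w] by auto
      ultimately have "?m = 0 \<or> 0 \<le> ?m \<and> Y b \<le> 0" by (auto simp: min_def)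
      hence "?m * Y b \<le> 0" by (auto simp: mult_nonneg_nonpos)
      thus ?thesis using le by simp
    next
      case True
      have pos: "0 < sum w ?A" "0 < sum w ?B"
        using True branch_pos_imp_sum_pos[of w, OF w] by blast+
      have fin: "finite ?A" "finite ?B" and ek: "(e + 1) + j = k" using prems by auto
      have sep: "separates (if b then T1 else T0) ?A ?B"
        using separates_Query[OF prems(6)] by (cases b) auto
      have "affinity w (truncate j (if b then T1 else T0)) ?A ?B \<le> N * s b * (1 - Y b)"
        unfolding Ns[symmetric] Y_def X_def
        using "3.IH"(1)[OF ek fin(1) pos(1) fin(2) pos(2)] "3.IH"(2)[OF ek fin(1) pos(1) fin(2) pos(2)] sep
        by (cases b) simp_all
      hence "a b \<le> s b - s b * Y b" using N by (simp add: a_def field_simps)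
      moreover have "?m \<le> s b"
        using True unfolding s_def by (intro real_le_rsqrt)
          (auto simp: power2_eq_square intro!: mult_mono)
      ultimately show ?thesis using True mult_right_mono[of ?m "s b" "Y b"] by linarith
    qed
  qed
  have m1: "min (1 - p) (1 - q) = 1 - \<bar>p - q\<bar> - min p q" by (auto simp: min_def abs_if)
  have "a False + a True \<le> s False + s True - (min p q * Y False + min (1 - p) (1 - q) * Y True)"
    using child[of False] child[of True] by (simp add: pq p_q_def[symmetric])
  also have "s False + s True \<le> 1 - \<bar>p - q\<bar>\<^sup>2 / 2"
    using affinity_coins_le[OF pq01] by (simp add: s_def pq p_q_def[symmetric])
  finally have a: "a False + a True \<le>
      1 - \<bar>p - q\<bar>\<^sup>2 / 2 - (min p q * Y False + min (1 - p) (1 - q) * Y True)" by simp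
  define D where "D = \<bar>p - q\<bar>"
  have D: "0 \<le> D" by (simp add: D_def)
  define Z where "Z = real (e + 1) * D + min p q * X False + min (1 - p) (1 - q) * X True"
  have split: "min p q * Y False + min (1 - p) (1 - q) * Y True =
      ((1 - D) * (1 - j / (4 * k)) - (Z - real (e + 1) * D) / k) / (2 * k)"
    unfolding Y_def Z_def m1 D_def using k(1) by (simp add: field_simps)
  have gain: "(1 - Z / k - Suc j / (4 * k)) / (2 * k) \<le> D\<^sup>2 / 2 +
      ((1 - D) * (1 - j / (4 * k)) - (Z - real (e + 1) * D) / k) / (2 * k)"
  proof -
    \<comment> \<open>Completing the square loses \<open>1 / (4 * k)\<close> once per level, which
      is the step from \<open>j\<close> to \<open>Suc j\<close> in the bound.\<close>
    have "0 \<le> (2 * k * D - 1)\<^sup>2" by simp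
    hence "D - 1 / (4 * k) \<le> k * D\<^sup>2"
      using k(1) by (simp add: power2_eq_square field_simps)
    moreover have "0 \<le> D * (j / (4 * k)) + real (e + 1) * D / k" using D by simp
    ultimately have "1 - Z / k - Suc j / (4 * k) \<le> k * D\<^sup>2 +
        ((1 - D) * (1 - j / (4 * k)) - (Z - real (e + 1) * D) / k)"
      using k(1) by (simp add: algebra_simps add_divide_distrib diff_divide_distrib)
    hence "(1 - Z / k - Suc j / (4 * k)) / (2 * k) \<le> (k * D\<^sup>2 +
        ((1 - D) * (1 - j / (4 * k)) - (Z - real (e + 1) * D) / k)) / (2 * k)"
      by (intro divide_right_mono) auto
    thus ?thesis using k(1) by (simp add: add_divide_distrib)
  qed
  have "x \<le> 1 - v" if "y = u" "v \<le> d + u" "x \<le> 1 - d - y" for x y u v d :: real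
    using that by linarith
  from this[OF split gain a[folded D_def]]
  have "a False + a True \<le> 1 - (1 - Z / k - Suc j / (4 * k)) / (2 * k)" .
  hence "N * (a False + a True) \<le> N * (1 - (1 - Z / k - Suc j / (4 * k)) / (2 * k))"
    using N by (intro mult_left_mono) auto
  moreover have "N * (a False + a True) = affinity w (truncate (Suc j) (Query i T0 T1)) A B"
    using N by (simp add: a_def distrib_left)
  moreover have "Z = weighted_conflict w e (Query i T0 T1) A B"
    by (simp add: Z_def D_def X_def pq p_q_def)
  ultimately show ?case by (simp only: N_def)
qed

section \<open>Composing trees and labelling leaves\<close>

text \<open>Affinity is a sum over leaves, so replacing each leaf by a tree that contracts the pair
  seen there contracts the whole. \<open>step\<close> ranges over all subsets because each leaf sees
  its own restriction of the pair.\<close>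

lemma ex_graft:
  assumes step: "\<And>A B. A \<subseteq> X \<Longrightarrow> B \<subseteq> Y \<Longrightarrow> \<exists>S \<in> dtrees m. tree_height S \<le> k \<and>
      affinity w (S :: 's dtree) A B \<le> \<rho> * sqrt (sum w A * sum w B)"
    and "T \<in> dtrees m" "A \<subseteq> X" "B \<subseteq> Y"
  shows "\<exists>S \<in> dtrees m. tree_height S \<le> tree_height T + k \<and>
      affinity w (S :: 's dtree) A B \<le> \<rho> * affinity w (T :: 's dtree) A B"
  using assms(2-)
proof (induction T arbitrary: A B)
  case (Output s)
  thus ?case using step[of A B] by simp
next
  case (Query i T0 T1)
  have T: "T0 \<in> dtrees m" "T1 \<in> dtrees m" "i < m" using Query.prems(1) by (auto simp: dtrees_def)
  have sub: "{x \<in> A. x ! i = b} \<subseteq> X" "{x \<in> B. x ! i = b} \<subseteq> Y" for b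
    using Query.prems by auto
  obtain S0 :: "'s dtree" where S0: "S0 \<in> dtrees m" "tree_height S0 \<le> tree_height T0 + k"
    "affinity w S0 {x \<in> A. x ! i = False} {x \<in> B. x ! i = False} \<le>
       \<rho> * affinity w T0 {x \<in> A. x ! i = False} {x \<in> B. x ! i = False}"
    using Query.IH(1)[OF T(1) sub[of False]] by blast
  obtain S1 :: "'s dtree" where S1: "S1 \<in> dtrees m" "tree_height S1 \<le> tree_height T1 + k"
    "affinity w S1 {x \<in> A. x ! i = True} {x \<in> B. x ! i = True} \<le>
       \<rho> * affinity w T1 {x \<in> A. x ! i = True} {x \<in> B. x ! i = True}"
    using Query.IH(2)[OF T(2) sub[of True]] by blast
  have "Query i S0 S1 \<in> dtrees m" using S0(1) S1(1) T(3) by (auto simp: dtrees_def)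
  moreover have "tree_height (Query i S0 S1) \<le> tree_height (Query i T0 T1) + k" using S0(2) S1(2) by auto
  moreover have "affinity w (Query i S0 S1) A B \<le> \<rho> * affinity w (Query i T0 T1) A B"
    using S0(3) S1(3) by (simp add: distrib_left)
  ultimately show ?case by blast
qed

lemma ex_iterated_graft:
  assumes step: "\<And>A B. A \<subseteq> X \<Longrightarrow> B \<subseteq> Y \<Longrightarrow> \<exists>S \<in> dtrees m. tree_height S \<le> k \<and>
      affinity w (S :: 's dtree) A B \<le> \<rho> * sqrt (sum w A * sum w B)"
    and "0 \<le> \<rho>"
  shows "\<exists>S \<in> dtrees m. tree_height S \<le> t * k \<and>
      affinity w (S :: 's dtree) X Y \<le> \<rho> ^ t * sqrt (sum w X * sum w Y)"
proof (induction t)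
  case 0
  show ?case by (intro bexI[of _ "Output undefined"]) (auto simp: dtrees_def)
next
  case (Suc t)
  then obtain T :: "'s dtree" where T: "T \<in> dtrees m" "tree_height T \<le> t * k"
    "affinity w T X Y \<le> \<rho> ^ t * sqrt (sum w X * sum w Y)" by blast
  obtain S :: "'s dtree" where S: "S \<in> dtrees m" "tree_height S \<le> tree_height T + k"
    "affinity w S X Y \<le> \<rho> * affinity w T X Y"
    using ex_graft[where X = X and Y = Y, OF step T(1), of X Y] by blast
  have "affinity w S X Y \<le> \<rho> ^ Suc t * sqrt (sum w X * sum w Y)"
    using S(3) mult_left_mono[OF T(3) assms(2)] by (simp add: mult.assoc)
  thus ?case using S T by (intro bexI[of _ S]) auto
qed

text \<open>A leaf labelled by its heavier side errs with the lighter one, and a minimum is at most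
  the geometric mean. The correct label is \<open>False\<close> on \<open>A\<close> and
  \<open>True\<close> on \<open>B\<close>.\<close>

lemma ex_labelling:
  assumes w: "\<And>x. 0 \<le> w x"
    and "T \<in> dtrees m" "finite A" "finite B"
  shows "\<exists>S \<in> dtrees m. tree_height S = tree_height T \<and>
      sum w {x \<in> A. run S x} + sum w {x \<in> B. \<not> run S x} \<le> affinity w T A B"
  using assms(2-)
proof (induction T arbitrary: A B)
  case (Output s)
  have "min (sum w A) (sum w B) \<le> sqrt (sum w A * sum w B)"
    using w by (intro real_le_rsqrt) (auto simp: power2_eq_square min_def sum_nonneg intro!: mult_mono)
  thus ?case
    by (intro bexI[of _ "Output (sum w A \<le> sum w B)"])
       (cases "sum w A \<le> sum w B"; simp add: dtrees_def)+
next
  case (Query i T0 T1)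
  have T: "T0 \<in> dtrees m" "T1 \<in> dtrees m" "i < m" using Query.prems(1) by (auto simp: dtrees_def)
  let ?H = "\<lambda>C b. {x \<in> C. x ! i = b}"
  obtain S0 where S0: "S0 \<in> dtrees m" "tree_height S0 = tree_height T0"
    "sum w {x \<in> ?H A False. run S0 x} + sum w {x \<in> ?H B False. \<not> run S0 x} \<le>
       affinity w T0 (?H A False) (?H B False)"
    using Query.IH(1)[OF T(1), of "?H A False" "?H B False"] Query.prems by auto
  obtain S1 where S1: "S1 \<in> dtrees m" "tree_height S1 = tree_height T1"
    "sum w {x \<in> ?H A True. run S1 x} + sum w {x \<in> ?H B True. \<not> run S1 x} \<le>
       affinity w T1 (?H A True) (?H B True)"
    using Query.IH(2)[OF T(2), of "?H A True" "?H B True"] Query.prems by auto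
  let ?S = "Query i S0 S1"
  have "?H {x \<in> C. run ?S x = c} False = {x \<in> ?H C False. run S0 x = c}"
    "?H {x \<in> C. run ?S x = c} True = {x \<in> ?H C True. run S1 x = c}" for C c
    by auto
  hence split: "sum w {x \<in> C. run ?S x = c} =
      sum w {x \<in> ?H C False. run S0 x = c} + sum w {x \<in> ?H C True. run S1 x = c}"
    if "finite C" for C c
    using sum_branch[of "{x \<in> C. run ?S x = c}" w i] that by simp
  have "sum w {x \<in> A. run ?S x} + sum w {x \<in> B. \<not> run ?S x} \<le> affinity w (Query i T0 T1) A B"
    using split[OF Query.prems(2), of True] split[OF Query.prems(3), of False] S0(3) S1(3)
    by (simp del: run.simps)
  moreover have "?S \<in> dtrees m" using S0(1) S1(1) T(3) by (auto simp: dtrees_def)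
  moreover have "tree_height ?S = tree_height (Query i T0 T1)" using S0 S1 by simp
  ultimately show ?case by blast
qed

section \<open>Minimax\<close>

text \<open>
  Multiplicative weights: each point is reweighted by \<open>3/2\<close> whenever the current response fails on it.
  The total weight grows by a factor of at most \<open>9/8\<close> per round, and \<open>(9/8)\<^sup>3 < 3/2\<close>, so
  no point can see failures in more than a third of sufficiently many rounds.
\<close>

lemma ex_mixed_strategy:
  fixes fails :: "'h \<Rightarrow> 'x \<Rightarrow> bool"
  assumes X: "finite X"
    and response: "\<And>w :: 'x \<Rightarrow> real. (\<And>x. 0 \<le> w x) \<Longrightarrow>
      \<exists>h \<in> H. sum w {x \<in> X. fails h x} \<le> sum w X / 4"
  shows "\<exists>A. set_pmf A \<subseteq> H \<and> (\<forall>x \<in> X. measure_pmf.prob A {h. fails h x} \<le> 1 / 3)"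
proof -
  obtain best :: "('x \<Rightarrow> real) \<Rightarrow> 'h" where best: "\<And>w. (\<And>x. 0 \<le> w x) \<Longrightarrow> best w \<in> H"
    "\<And>w. (\<And>x. 0 \<le> w x) \<Longrightarrow> sum w {x \<in> X. fails (best w) x} \<le> sum w X / 4"
    using response by metis
  define w where "w n = ((\<lambda>w x. w x * (if fails (best w) x then 3 / 2 else 1)) ^^ n) (\<lambda>_. 1 :: real)" for n
  have w_Suc: "w (Suc n) x = w n x * (if fails (best (w n)) x then 3 / 2 else 1)" for n x
    by (simp add: w_def)
  define F where "F n x = {s. s < n \<and> fails (best (w s)) x}" for n x
  have w_eq: "w n x = (3 / 2) ^ card (F n x)" for n x
  proof (induction n)
    case 0
    show ?case by (simp add: w_def F_def)
  next
    case (Suc n)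
    have "F (Suc n) x = (if fails (best (w n)) x then insert n (F n x) else F n x)"
      by (auto simp: F_def less_Suc_eq)
    moreover have "finite (F n x)" "n \<notin> F n x" by (auto simp: F_def)
    ultimately show ?case using Suc by (simp add: w_Suc)
  qed
  have nonneg: "0 \<le> w n x" for n x by (simp add: w_eq)
  have total: "sum (w n) X \<le> card X * (9 / 8) ^ n" for n
  proof (induction n)
    case 0
    show ?case by (simp add: w_def)
  next
    case (Suc n)
    \<comment> \<open>Failing points gain half their weight and carry at most a quarter of the
      total, hence growth by \<open>1 + 1/8\<close>.\<close>
    have "sum (w (Suc n)) X = (\<Sum>x\<in>X. w n x + (if fails (best (w n)) x then w n x else 0) / 2)"
      by (intro sum.cong) (auto simp: w_Suc)
    also have "\<dots> = sum (w n) X + sum (w n) {x \<in> X. fails (best (w n)) x} / 2"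
      using X by (simp add: sum.distrib sum.inter_filter flip: sum_divide_distrib)
    also have "\<dots> \<le> 9 / 8 * sum (w n) X"
      using best(2)[of "w n", OF nonneg] by simp
    also have "\<dots> \<le> card X * (9 / 8) ^ Suc n" using Suc by simp
    finally show ?case .
  qed
  \<comment> \<open>\<open>256 / 243\<close> is \<open>(3 / 2) / (9 / 8)^3\<close>: over three
    rounds, a point failing once outgrows the total by this factor. Enough such blocks beat the
    initial weight \<open>card X\<close>.\<close>
  obtain M0 where M0: "real (card X) < (256 / 243) ^ M0"
    using real_arch_pow[of "256 / 243" "card X"] by auto
  \<comment> \<open>The successor keeps the set of rounds nonempty.\<close>
  define M where "M = Suc M0"
  have "(256 / 243 :: real) ^ M0 \<le> (256 / 243) ^ M" by (simp add: M_def)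
  with M0 have M: "real (card X) < (256 / 243) ^ M" by (rule less_le_trans)
  have few: "card (F (3 * M) x) \<le> M" if "x \<in> X" for x
  proof (rule ccontr)
    assume "\<not> card (F (3 * M) x) \<le> M"
    hence "(3 / 2 :: real) ^ M \<le> w (3 * M) x" unfolding w_eq by (intro power_increasing) auto
    also have "\<dots> \<le> sum (w (3 * M)) X" using that X nonneg by (intro member_le_sum) auto
    also have "\<dots> \<le> card X * (729 / 512) ^ M"
      using total[of "3 * M"] by (simp add: power_mult power_divide)
    also have "\<dots> < (256 / 243) ^ M * (729 / 512) ^ M" using M by simp
    also have "\<dots> = (3 / 2 :: real) ^ M" by (simp flip: power_mult_distrib)
    finally show False by simp
  qed
  \<comment> \<open>Play the response of a uniformly random round.\<close>
  define A where "A = map_pmf (\<lambda>s. best (w s)) (pmf_of_set {..<3 * M})"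
  have ne: "{..<3 * M} \<noteq> {}" by (simp add: M_def lessThan_empty_iff)
  have "best (w s) \<in> H" for s by (rule best(1)) (rule nonneg)
  hence "set_pmf A \<subseteq> H" using ne by (auto simp: A_def)
  moreover have "measure_pmf.prob A {h. fails h x} \<le> 1 / 3" if "x \<in> X" for x
  proof -
    have "{..<3 * M} \<inter> (\<lambda>s. best (w s)) -` {h. fails h x} = F (3 * M) x" by (auto simp: F_def)
    hence "measure_pmf.prob A {h. fails h x} = card (F (3 * M) x) / (3 * M)"
      using ne by (simp add: A_def measure_pmf_of_set)
    also have "\<dots> \<le> M / (3 * M)" using few[OF that] by (intro divide_right_mono) auto
    also have "\<dots> = 1 / 3" by (simp add: M_def)
    finally show ?thesis .
  qed
  ultimately show ?thesis by blast
qed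

section \<open>Boundedness of conflict and trees of low conflict\<close>

lemma cond_prob_pmf_bounds:
  "0 \<le> \<P>(x in measure_pmf \<mu>. P x \<bar> Q x)" "\<P>(x in measure_pmf \<mu>. P x \<bar> Q x) \<le> 1"
proof -
  have "measure_pmf.prob \<mu> {x. P x \<and> Q x} \<le> measure_pmf.prob \<mu> {x. Q x}"
    by (intro measure_pmf.finite_measure_mono) auto
  thus "\<P>(x in measure_pmf \<mu>. P x \<bar> Q x) \<le> 1" by (simp add: cond_prob_def divide_le_eq_1 less_le)
  show "0 \<le> \<P>(x in measure_pmf \<mu>. P x \<bar> Q x)" by (simp add: cond_prob_def)
qed

lemma node_weight_bounds: "0 \<le> node_weight m T P v \<and> node_weight m T P v \<le> 1"
proof (induction v rule: rev_induct)
  case Nil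
  show ?case by (simp add: node_weight.simps)
next
  case (snoc b v)
  have "0 \<le> min (step_prob m T (fst P) (v @ [b])) (step_prob m T (snd P) (v @ [b]))"
    "min (step_prob m T (fst P) (v @ [b])) (step_prob m T (snd P) (v @ [b])) \<le> 1"
    unfolding step_prob_def by (simp_all add: cond_prob_pmf_bounds min_le_iff_disj)
  thus ?case using snoc
    by (subst (1 2) node_weight.simps) (simp add: mult_le_one)
qed

lemma node_gap_bounds: "0 \<le> node_gap m T P v \<and> node_gap m T P v \<le> 1"
proof -
  have "0 \<le> prob_zero m T \<mu> v \<and> prob_zero m T \<mu> v \<le> 1" for \<mu>
    by (simp only: prob_zero_def cond_prob_pmf_bounds simp_thms)
  from this[of "fst P"] this[of "snd P"] show ?thesis by (auto simp: node_gap_def abs_if)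
qed

lemma conflict_pair_nonneg: "0 \<le> conflict_pair m T P"
  unfolding conflict_pair_def 
  by (intro sum_nonneg mult_nonneg_nonneg conjunct1[OF node_weight_bounds] conjunct1[OF node_gap_bounds]) simp

lemma conflict_pair_le: "conflict_pair m T P \<le> (\<Sum>v \<in> internal_nodes T. real (node_depth v))"
  unfolding conflict_pair_def
proof (intro sum_mono)
  fix v
  have "node_gap m T P v * node_weight m T P v \<le> 1"
    using node_weight_bounds[of m T P v] node_gap_bounds[of m T P v] by (intro mult_le_one) auto
  hence "real (node_depth v) * (node_gap m T P v * node_weight m T P v) \<le> real (node_depth v) * 1"
    by (intro mult_left_mono) auto
  thus "real (node_depth v) * node_gap m T P v * node_weight m T P v \<le> real (node_depth v)"
    by (simp add: mult.assoc)
qed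

lemma conflict_nonneg: "0 \<le> conflict m T Q"
  unfolding conflict_def by (intro Bochner_Integration.integral_nonneg conflict_pair_nonneg)

lemma conflict_le: "conflict m T Q \<le> (\<Sum>v \<in> internal_nodes T. real (node_depth v))"
  unfolding conflict_def
  by (intro measure_pmf.integral_le_const measure_pmf.integrable_const_bound[of _ "\<Sum>v \<in> internal_nodes T. real (node_depth v)"])
     (auto simp: conflict_pair_le conflict_pair_nonneg)

text \<open>A real \<open>SUP\<close> dominates its members only if they are bounded; one fixed tree
  computing \<open>g\<close> bounds the infimum uniformly in \<open>Q\<close>.\<close>

lemma INF_conflict_le_max_conflict_complexity:
  assumes "partial_boolean_function m g" "Q \<in> pair_distributions g"
  shows "(INF T \<in> {T \<in> dtrees m. computes T g}. conflict m T Q) \<le> max_conflict_complexity m g"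
proof -
  obtain T0 where T0: "T0 \<in> dtrees m" "computes T0 g" using ex_dtree_computes[OF assms(1)] by blast
  have "bdd_above ((\<lambda>Q. INF T \<in> {T \<in> dtrees m. computes T g}. conflict m T Q) ` pair_distributions g)"
    by (intro bdd_aboveI2[of _ _ "\<Sum>v \<in> internal_nodes T0. real (node_depth v)"]
          cINF_lower2[of _ _ T0] bdd_belowI2[of _ 0])
       (auto simp: T0 conflict_le conflict_nonneg)
  thus ?thesis using assms(2)
    by (auto simp: max_conflict_complexity_def intro!: cSUP_upper2[of _ _ Q])
qed

text \<open>The strict bound \<open>c\<close> lets the infimum yield a tree whether or not it is
  attained.\<close>

lemma ex_low_conflict:
  assumes g: "partial_boolean_function m g" and w: "\<And>x. 0 \<le> w x"
    and A: "A \<subseteq> preimage g False" "0 < sum w A" and B: "B \<subseteq> preimage g True" "0 < sum w B"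
    and c: "max_conflict_complexity m g < c"
  shows "\<exists>T \<in> dtrees m. computes T g \<and> weighted_conflict w 0 T A B < c"
proof -
  have sub: "A \<subseteq> cube m" "B \<subseteq> cube m" using A B preimage_subset_cube[OF g] by blast+
  hence fin: "finite A" "finite B" using finite_cube finite_subset by blast+
  define Q where "Q = return_pmf (normalized w A, normalized w B)"
  have "Q \<in> pair_distributions g"
    using set_pmf_normalized[OF fin(1) w A(2)] set_pmf_normalized[OF fin(2) w B(2)] A B
    by (auto simp: Q_def pair_distributions_def)
  hence "(INF T \<in> {T \<in> dtrees m. computes T g}. conflict m T Q) < c"
    using INF_conflict_le_max_conflict_complexity[OF g] c by (meson le_less_trans)
  moreover have "{T \<in> dtrees m. computes T g} \<noteq> {}" using ex_dtree_computes[OF g] by blast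
  moreover have "bdd_below ((\<lambda>T. conflict m T Q) ` {T \<in> dtrees m. computes T g})"
    by (intro bdd_belowI2[of _ 0] conflict_nonneg)
  ultimately obtain T where "T \<in> dtrees m" "computes T g" "conflict m T Q < c"
    by (subst (asm) cINF_less_iff) auto
  thus ?thesis
    using conflict_pair_normalized[OF w sub(1) A(2) sub(2) B(2), of T] by (auto simp: conflict_def Q_def)
qed

lemma separates_if_computes:
  assumes "computes T g" "A \<subseteq> preimage g False" "B \<subseteq> preimage g True"
  shows "separates T A B"
  unfolding separates_def
proof (intro ballI)
  fix x y assume "x \<in> A" "y \<in> B"
  hence "x \<in> preimage g False" "y \<in> preimage g True" using assms by blast+
  hence "run T x = False" "run T y = True" using assms(1) unfolding computes_def by blast+
  thus "run T x \<noteq> run T y" by simp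
qed

text \<open>Conflict has total probability 1 and costs at least 1, already for the uniform pair. The
  bound absorbs the rounding of \<open>k\<close> in \<open>theorem1\<close>.\<close>

lemma max_conflict_complexity_ge_1:
  assumes g: "partial_boolean_function m g" and "preimage g False \<noteq> {}" "preimage g True \<noteq> {}"
  shows "1 \<le> max_conflict_complexity m g"
proof (rule ccontr)
  assume "\<not> ?thesis"
  hence c: "max_conflict_complexity m g < 1" by simp
  have fin: "finite (preimage g b)" for b
    using preimage_subset_cube[OF g] finite_cube finite_subset by blast
  let ?w = "\<lambda>_ :: bool list. 1 :: real"
  have pos: "0 < sum ?w (preimage g False)" "0 < sum ?w (preimage g True)"
    using assms fin by (auto simp: card_gt_0_iff)
  obtain T where "computes T g" "weighted_conflict ?w 0 T (preimage g False) (preimage g True) < 1"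
    using ex_low_conflict[OF g _ order_refl pos(1) order_refl pos(2) c] by auto
  with weighted_conflict_ge[OF _ fin pos(1) fin pos(2), of T 0] show False
    by (auto simp: separates_if_computes)
qed

section \<open>Trees of small distributional error\<close>

text \<open>One stage of the iteration. Of the conflict probability 1, at most 1/2 is lost beyond
  depth \<open>k\<close>, as in Markov's inequality, and 1/4 to completing squares; the remaining
  1/4 is divided by \<open>2 * k\<close>.\<close>

lemma ex_contracting_dtree:
  assumes g: "partial_boolean_function m g" and w: "\<And>x. 0 \<le> w x"
    and A: "A \<subseteq> preimage g False" and B: "B \<subseteq> preimage g True"
    and k: "0 < k" "2 * max_conflict_complexity m g < real k"
  shows "\<exists>S \<in> dtrees m. tree_height S \<le> k \<and>
    affinity w (S :: bool dtree) A B \<le> (1 - 1 / (8 * real k)) * sqrt (sum w A * sum w B)"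
proof (cases "0 < sum w A \<and> 0 < sum w B")
  \<comment> \<open>Leaves that one side misses can occur while grafting; their affinity is already
    0.\<close>
  case False
  hence "sum w A * sum w B = 0"
    using sum_nonneg[of A w] sum_nonneg[of B w] w by (auto simp: not_less)
  thus ?thesis by (intro bexI[of _ "Output True"]) (auto simp: dtrees_def)
next
  case True
  have "A \<subseteq> cube m" "B \<subseteq> cube m" using A B preimage_subset_cube[OF g] by blast+
  hence fin: "finite A" "finite B" using finite_cube finite_subset by blast+
  obtain T where T: "T \<in> dtrees m" "computes T g" "weighted_conflict w 0 T A B < real k / 2"
    using ex_low_conflict[of m g w A B "real k / 2", OF g w A _ B] True k(2) by auto
  let ?Z = "weighted_conflict w 0 T A B"
  have "affinity w (truncate k T) A B \<le>
      sqrt (sum w A * sum w B) * (1 - (1 - ?Z / k - k / (4 * k)) / (2 * k))"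
    using True fin k(1) separates_if_computes[OF T(2) A B] w by (intro affinity_truncate_le) auto
  also have "\<dots> \<le> sqrt (sum w A * sum w B) * (1 - 1 / (8 * real k))"
  proof (intro mult_left_mono)
    have quarter: "k / (4 * k) = (1 / 4 :: real)" using k(1) by simp
    have "?Z / k \<le> 1 / 2" using T(3) k(1) by (simp add: field_simps)
    hence "(1 / 4) / (2 * k) \<le> (1 - ?Z / k - k / (4 * k)) / (2 * k)"
      unfolding quarter by (intro divide_right_mono) linarith+
    thus "1 - (1 - ?Z / k - k / (4 * k)) / (2 * k) \<le> 1 - 1 / (8 * real k)" by simp
  qed (use True in auto)
  also have "\<dots> = (1 - 1 / (8 * real k)) * sqrt (sum w A * sum w B)" by (rule mult.commute)
  finally have "affinity w (truncate k T) A B \<le> (1 - 1 / (8 * real k)) * sqrt (sum w A * sum w B)" .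
  moreover have "truncate k T \<in> dtrees m"
    using T(1) indices_truncate[of k T] by (auto simp: dtrees_def)
  ultimately show ?thesis using height_truncate by blast
qed

lemma ex_dtree_distributional:
  fixes w :: "bool list \<Rightarrow> real"
  assumes g: "partial_boolean_function m g" and w: "\<And>x. 0 \<le> w x"
    and k: "0 < k" "2 * max_conflict_complexity m g < real k"
  shows "\<exists>T \<in> dtrees m. tree_height T \<le> 8 * k\<^sup>2 \<and>
    sum w {x \<in> cube m. (x, run T x) \<notin> g} \<le> sum w (cube m) / 4"
proof -
  let ?A = "preimage g False" and ?B = "preimage g True" and ?\<rho> = "1 - 1 / (8 * real k)"
  have sub: "?A \<subseteq> cube m" "?B \<subseteq> cube m" using preimage_subset_cube[OF g] by blast+
  hence fin: "finite ?A" "finite ?B" using finite_cube finite_subset by blast+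
  obtain S :: "bool dtree" where S: "S \<in> dtrees m" "tree_height S \<le> (8 * k) * k"
    "affinity w S ?A ?B \<le> ?\<rho> ^ (8 * k) * sqrt (sum w ?A * sum w ?B)"
  proof -
    have "\<exists>S \<in> dtrees m. tree_height S \<le> k \<and>
        affinity w (S :: bool dtree) A B \<le> ?\<rho> * sqrt (sum w A * sum w B)"
      if "A \<subseteq> ?A" "B \<subseteq> ?B" for A B
      using ex_contracting_dtree[OF g w that k] .
    moreover have "0 \<le> ?\<rho>" using k(1) by (simp add: field_simps)
    ultimately show ?thesis
      using that ex_iterated_graft[of ?A ?B m k w ?\<rho> "8 * k"] by blast
  qed
  obtain T where T: "T \<in> dtrees m" "tree_height T = tree_height S"
    "sum w {x \<in> ?A. run T x} + sum w {x \<in> ?B. \<not> run T x} \<le> affinity w S ?A ?B"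
    using ex_labelling[of w, OF w S(1) fin] by blast
  \<comment> \<open>The number \<open>8 * k\<close> of stages is chosen so that the contraction
    compounds to at most \<open>exp (- 1)\<close>.\<close>
  have "?\<rho> ^ (8 * k) \<le> exp (- 1 / (8 * real k)) ^ (8 * k)"
    using k(1) exp_ge_add_one_self[of "- 1 / (8 * real k)"] by (intro power_mono) (auto simp: field_simps)
  also have "\<dots> = exp (- 1)" using k(1) by (simp flip: exp_of_nat_mult)
  also have "\<dots> \<le> 1 / 2" using exp_ge_add_one_self[of 1] by (simp add: exp_minus field_simps)
  finally have "affinity w S ?A ?B \<le> 1 / 2 * sqrt (sum w ?A * sum w ?B)"
    using S(3) w by (meson mult_right_mono order_trans real_sqrt_ge_zero mult_nonneg_nonneg sum_nonneg)
  \<comment> \<open>The arithmetic mean supplies the second factor 1/2 of the error 1/4.\<close>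
  also have "\<dots> \<le> 1 / 2 * ((sum w ?A + sum w ?B) / 2)"
    using w by (intro mult_left_mono arith_geo_mean_sqrt sum_nonneg) auto
  also have "sum w ?A + sum w ?B = sum w (?A \<union> ?B)"
    using fin by (intro sum.union_disjoint[symmetric]) (auto simp: preimage_def)
  also have "1 / 2 * (sum w (?A \<union> ?B) / 2) \<le> sum w (cube m) / 4"
    using sub w finite_cube by (simp add: sum_mono2)
  finally have "affinity w S ?A ?B \<le> sum w (cube m) / 4" .
  moreover have "{x \<in> cube m. (x, run T x) \<notin> g} = {x \<in> ?A. run T x} \<union> {x \<in> ?B. \<not> run T x}"
  proof (intro set_eqI)
    fix x
    show "x \<in> {x \<in> cube m. (x, run T x) \<notin> g} \<longleftrightarrow> x \<in> {x \<in> ?A. run T x} \<union> {x \<in> ?B. \<not> run T x}"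
      using notin_iff_preimage[OF g, of x "run T x"] sub by (cases "run T x") auto
  qed
  moreover have "sum w ({x \<in> ?A. run T x} \<union> {x \<in> ?B. \<not> run T x}) =
      sum w {x \<in> ?A. run T x} + sum w {x \<in> ?B. \<not> run T x}"
    using fin by (intro sum.union_disjoint) auto
  ultimately have "sum w {x \<in> cube m. (x, run T x) \<notin> g} \<le> sum w (cube m) / 4"
    using T(3) by simp
  moreover have "tree_height T \<le> 8 * k\<^sup>2" using T(2) S(2) by (simp add: power2_eq_square)
  ultimately show ?thesis using T(1) by blast
qed

section \<open>Randomized algorithms and the lower bound\<close>

lemma randomized_query_complexity_le:
  assumes "set_pmf A \<subseteq> {T \<in> dtrees m. tree_height T \<le> q}"
    and "\<And>x. x \<in> cube m \<Longrightarrow> measure_pmf.prob A {T. (x, run T x) \<notin> h} \<le> \<epsilon>"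
  shows "randomized_query_complexity \<epsilon> m h \<le> q"
proof -
  have "1 - \<epsilon> \<le> measure_pmf.prob A {T. (x, run T x) \<in> h}" if "x \<in> cube m" for x
  proof -
    have "measure_pmf.prob A {T. (x, run T x) \<notin> h} = 1 - measure_pmf.prob A {T. (x, run T x) \<in> h}"
      by (subst measure_pmf.prob_compl[symmetric]) (auto intro: arg_cong[where f = "measure_pmf.prob A"])
    thus ?thesis using assms(2)[OF that] by simp
  qed
  hence "randomized_algorithm \<epsilon> m h A"
    using assms(1) by (auto simp: randomized_algorithm_def)
  moreover have "\<forall>T \<in> set_pmf A. \<forall>x \<in> cube m. length (answers T x) \<le> q"
    using assms(1) length_answers_le_height order_trans by blast
  ultimately show ?thesis
    unfolding randomized_query_complexity_def by (intro Least_le) blast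
qed

text \<open>A game of shallow trees against inputs: every weighting of the inputs has a tree of
  error 1/4, and the gap to 1/3 makes finitely many rounds of multiplicative weights
  suffice.\<close>

lemma randomized_query_complexity_le_conflict:
  assumes g: "partial_boolean_function m g"
    and k: "0 < k" "2 * max_conflict_complexity m g < real k"
  shows "randomized_query_complexity (1 / 3) m g \<le> 8 * k\<^sup>2"
proof -
  obtain A where "set_pmf A \<subseteq> {T \<in> dtrees m. tree_height T \<le> 8 * k\<^sup>2}"
    "\<forall>x \<in> cube m. measure_pmf.prob A {T. (x, run T x) \<notin> g} \<le> 1 / 3"
  proof -
    have "\<exists>T \<in> {T \<in> dtrees m. tree_height T \<le> 8 * k\<^sup>2}.
        sum w {x \<in> cube m. (x, run T x) \<notin> g} \<le> sum w (cube m) / 4"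
      if "\<And>x. 0 \<le> w x" for w :: "bool list \<Rightarrow> real"
      using ex_dtree_distributional[of m g w, OF g that k] by blast
    from ex_mixed_strategy[where fails = "\<lambda>T x. (x, run T x) \<notin> g", OF finite_cube this] that
    show ?thesis by blast
  qed
  thus ?thesis by (intro randomized_query_complexity_le) auto
qed

lemma randomized_query_complexity_constant:
  assumes g: "partial_boolean_function m g" and "preimage g (\<not> b) = {}"
  shows "randomized_query_complexity (1 / 3) m g = 0"
proof -
  have "(x, b) \<in> g" if "x \<in> cube m" for x
    using notin_iff_preimage[OF g that, of b] assms(2) by blast
  hence "randomized_query_complexity (1 / 3) m g \<le> 0"
    by (intro randomized_query_complexity_le[of "return_pmf (Output b)"]) (auto simp: dtrees_def)
  thus ?thesis by simp
qed

theorem theorem1: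
  shows "\<exists>c > 0. \<forall>m > 0. \<forall>g. partial_boolean_function m g \<longrightarrow>
           max_conflict_complexity m g \<ge> c * sqrt (real (randomized_query_complexity (1/3) m g))"
proof (intro exI[of _ "1 / 15 :: real"] conjI allI impI)
  fix m :: nat and g
  assume g: "partial_boolean_function m g"
  let ?C = "max_conflict_complexity m g" and ?R = "randomized_query_complexity (1/3) m g"
  show "1 / 15 * sqrt (real ?R) \<le> ?C"
  proof (cases "preimage g False = {} \<or> preimage g True = {}")
    \<comment> \<open>With a value missing there is no pair and \<open>?C\<close> is 0 by
      convention, so \<open>?R\<close> must vanish: a constant output needs no query.\<close>
    case True
    hence "?R = 0"
      using randomized_query_complexity_constant[OF g, of True]
        randomized_query_complexity_constant[OF g, of False] by auto
    moreover have "pair_distributions g = {}"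
    proof -
      have "Q \<notin> pair_distributions g" for Q
      proof
        assume Q: "Q \<in> pair_distributions g"
        obtain \<mu>0 \<mu>1 where "(\<mu>0, \<mu>1) \<in> set_pmf Q" using set_pmf_not_empty[of Q] by fastforce
        with Q have "set_pmf \<mu>0 \<subseteq> preimage g False" "set_pmf \<mu>1 \<subseteq> preimage g True"
          by (auto simp: pair_distributions_def)
        thus False using True set_pmf_not_empty[of \<mu>0] set_pmf_not_empty[of \<mu>1] by auto
      qed
      thus ?thesis by blast
    qed
    ultimately show ?thesis by (simp add: max_conflict_complexity_def)
  next
    case False
    hence C: "1 \<le> ?C" using max_conflict_complexity_ge_1[OF g] by blast
    \<comment> \<open>The least integer strictly above \<open>2 * ?C\<close>; since
      \<open>1 \<le> ?C\<close>, it is at most \<open>3 * ?C\<close>.\<close>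
    define k where "k = nat \<lfloor>2 * ?C\<rfloor> + 1"
    have k: "0 < k" "2 * ?C < real k" "real k \<le> 2 * ?C + 1"
      using C unfolding k_def by linarith+
    have "real ?R \<le> real (8 * k\<^sup>2)"
      using randomized_query_complexity_le_conflict[OF g k(1,2)] of_nat_mono by blast
    also have "\<dots> \<le> 8 * (3 * ?C)\<^sup>2"
      using k C power_mono[of "real k" "3 * ?C" 2] by simp
    \<comment> \<open>\<open>8 * 9 = 72\<close> is below \<open>15^2 = 225\<close>, whence the
      constant \<open>1 / 15\<close>.\<close>
    also have "\<dots> \<le> (15 * ?C)\<^sup>2" by (simp add: power_mult_distrib)
    finally have "sqrt (real ?R) \<le> 15 * ?C" using C by (intro real_le_lsqrt) auto
    thus ?thesis by simp
  qed
qed simp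

end
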